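(* Let $\lambda_g,\lambda_p,p_g,p_p>0$, $\alpha>2$, $\rho_\lambda=\lambda_p/\lambda_g$ and $\eta=p_p/p_g$. Let $\Phi_g$ be a random shifted square grid of intensity $\lambda_g$ and $\Phi_p$ an independent homogeneous Poisson point process on $\mathbb{R}^2$ of intensity $\lambda_p$, and let $\mathcal{A}_p$ (resp. $\mathcal{A}_g$) be the event that the typical user at the origin is associated with a point of $\Phi_p$ (resp. $\Phi_g$). Then $$\mathbf{P}^0(\mathcal{A}_p)=\int_0^{\sqrt2}\Big(1-\frac{\pi}{4}r^2\Big)f(r)\,dr+\int_1^{\sqrt2}\Big(r^2\arccos(1/r)-\sqrt{r^2-1}\Big)f(r)\,dr,$$ and $\mathbf{P}^0(\mathcal{A}_g)=1-\mathbf{P}^0(\mathcal{A}_p)$, where $$f(r)=2\pi\,\frac{\rho_\lambda\,\eta^{2/\alpha}}{4}\,r\,\exp\Big(-\pi\,\frac{\rho_\lambda\,\eta^{2/\alpha}}{4}\,r^2\Big).$$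
   Context: Random shifted grid: with $s=1/\sqrt{\lambda_g}$ and $U$ uniform on $[-s/2,s/2]^2$, $\Phi_g=\{s k+U: k\in\mathbb{Z}^2\}$ (a single common shift). $\Phi_p$ is a homogeneous Poisson point process of intensity $\lambda_p$ independent of $\Phi_g$. Points of $\Phi=\Phi_g\cup\Phi_p$ are base stations; a base station at $X$ has transmit power $P_X=p_g$ if $X\in\Phi_g$ and $P_X=p_p$ if $X\in\Phi_p$. The user at the origin is associated with $X^\star=\arg\max_{X\in\Phi}P_X\|X\|^{-\alpha}$. Thus, with $R_g=\inf_{X\in\Phi_g}\|X\|$ and $R_p=\inf_{X\in\Phi_p}\|X\|$, $\mathcal{A}_p=\{p_pR_p^{-\alpha}>p_gR_g^{-\alpha}\}$ and $\mathcal{A}_g$ is its complement (up to a null event). $\mathbf{P}^0$ denotes probability for the typical user at the origin; since users form a stationary Poisson point process independent of $\Phi$, $\Phi$ has its ordinary law under $\mathbf{P}^0$. *)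

theory Defs
  imports "HOL-Probability.Probability"
begin

type_synonym plane = "real \<times> real"

definition locally_finite :: "plane set \<Rightarrow> bool" where
  "locally_finite S \<longleftrightarrow> (\<forall>B. bounded B \<longrightarrow> finite (S \<inter> B))"

text \<open>Simple point configurations in the plane, with the sigma-algebra generated by the
  counting maps of bounded Borel sets.\<close>

definition config_space :: "plane set measure" where
  "config_space = sigma (Collect locally_finite)
     {{S. locally_finite S \<and> card (S \<inter> B) = k} | B k. B \<in> sets borel \<and> bounded B}"

definition square_grid :: "real \<Rightarrow> plane \<Rightarrow> plane set" where
  "square_grid s u = {(s * of_int k\<^sub>1 + fst u, s * of_int k\<^sub>2 + snd u) | k\<^sub>1 k\<^sub>2 :: int. True}"

definition random_shifted_grid :: "'w measure \<Rightarrow> real \<Rightarrow> ('w \<Rightarrow> plane set) \<Rightarrow> bool" where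
  "random_shifted_grid M lam \<Phi> \<longleftrightarrow>
     (let s = 1 / sqrt lam in
      \<exists>U. U \<in> borel_measurable M \<and>
          distr M borel U = uniform_measure lborel ({- s / 2 .. s / 2} \<times> {- s / 2 .. s / 2}) \<and>
          (\<forall>\<omega> \<in> space M. \<Phi> \<omega> = square_grid s (U \<omega>)))"

text \<open>The count law is written out because the library's Poisson distribution requires a
  positive rate, while Lebesgue-null sets have rate 0.\<close>

definition poisson_process :: "'w measure \<Rightarrow> real \<Rightarrow> ('w \<Rightarrow> plane set) \<Rightarrow> bool" where
  "poisson_process M lam \<Phi> \<longleftrightarrow>
     \<Phi> \<in> measurable M config_space \<and>
     (\<forall>B k. B \<in> sets borel \<longrightarrow> bounded B \<longrightarrow>
        measure M {\<omega> \<in> space M. card (\<Phi> \<omega> \<inter> B) = k} =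
          (lam * measure lborel B) ^ k / fact k * exp (- (lam * measure lborel B))) \<and>
     (\<forall>F. finite F \<longrightarrow> disjoint F \<longrightarrow> (\<forall>B \<in> F. B \<in> sets borel \<and> bounded B) \<longrightarrow>
        prob_space.indep_vars M (\<lambda>_. count_space UNIV) (\<lambda>B \<omega>. card (\<Phi> \<omega> \<inter> B)) F)"

text \<open>A base station is a pair of a location and a transmit power. A location belonging to both
  point processes, which happens with probability 0, carries one station of each kind.\<close>

definition base_stations :: "real \<Rightarrow> real \<Rightarrow> plane set \<Rightarrow> plane set \<Rightarrow> (plane \<times> real) set" where
  "base_stations p\<^sub>g p\<^sub>p G P = G \<times> {p\<^sub>g} \<union> P \<times> {p\<^sub>p}"

text \<open>The power received at the origin, with values in \<^typ>\<open>ennreal\<close> so that a station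
  located at the origin is received with infinite power; over the reals, \<open>0 powr (- \<alpha>)\<close>
  would be 0.\<close>

definition received_power :: "real \<Rightarrow> plane \<times> real \<Rightarrow> ennreal" where
  "received_power \<alpha> b = ennreal (snd b) / ennreal (norm (fst b) powr \<alpha>)"

definition serves_origin :: "real \<Rightarrow> (plane \<times> real) set \<Rightarrow> plane \<times> real \<Rightarrow> bool" where
  "serves_origin \<alpha> S b \<longleftrightarrow> is_arg_max (received_power \<alpha>) (\<lambda>b. b \<in> S) b"

definition assoc_event_poisson ::
  "'w measure \<Rightarrow> real \<Rightarrow> real \<Rightarrow> real \<Rightarrow> ('w \<Rightarrow> plane set) \<Rightarrow> ('w \<Rightarrow> plane set) \<Rightarrow> 'w set" where
  "assoc_event_poisson M \<alpha> p\<^sub>g p\<^sub>p \<Phi>\<^sub>g \<Phi>\<^sub>p =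
     {\<omega> \<in> space M. \<exists>X \<in> \<Phi>\<^sub>p \<omega>. serves_origin \<alpha> (base_stations p\<^sub>g p\<^sub>p (\<Phi>\<^sub>g \<omega>) (\<Phi>\<^sub>p \<omega>)) (X, p\<^sub>p)}"

definition assoc_event_grid ::
  "'w measure \<Rightarrow> real \<Rightarrow> real \<Rightarrow> real \<Rightarrow> ('w \<Rightarrow> plane set) \<Rightarrow> ('w \<Rightarrow> plane set) \<Rightarrow> 'w set" where
  "assoc_event_grid M \<alpha> p\<^sub>g p\<^sub>p \<Phi>\<^sub>g \<Phi>\<^sub>p =
     {\<omega> \<in> space M. \<exists>X \<in> \<Phi>\<^sub>g \<omega>. serves_origin \<alpha> (base_stations p\<^sub>g p\<^sub>p (\<Phi>\<^sub>g \<omega>) (\<Phi>\<^sub>p \<omega>)) (X, p\<^sub>g)}"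

end

(* The Poisson station wins iff R_p <= c R_g with c = (p_p / p_g)^(1 / alpha), where R_p and R_g are
   the distances from the origin to the two point processes. Void probabilities and independence
   turn the probability of this event into E[1 - exp(-pi lam_p c^2 R_g^2)], and R_g is the norm of
   the shift U, since 0 is the grid index of a nearest point. After rescaling the cell to [-1,1]^2,
   the layer cake formula for the Rayleigh density f leaves the area of the part of the square
   outside the disc of radius r; for r > 1 the disc protrudes from the square in four circular
   segments of area r^2 arccos(1/r) - sqrt(r^2 - 1). Ties need no separate argument:
   both R_p < t and R_p <= t have probability 1 - exp(-pi lam_p t^2). *)

theory Submission
  imports Defs
begin

section \<open>Area of a square inside and outside a centred disc\<close>

text \<open>The area is integrated over vertical slices. For \<open>x\<close> in
  \<open>{-1..1}\<close> the slice is \<open>{- m x .. m x}\<close>, where \<open>m x\<close> is the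
  smaller of the half-side 1 and the half-chord of the circle; the vertical sides enter only through
  the range of \<open>x\<close>.\<close>

lemma square_disc_area_gt_one:
  fixes r :: real
  assumes r: "1 < r" "r \<le> sqrt 2"
  shows "measure lborel {v :: real \<times> real. v \<in> {-1..1} \<times> {-1..1} \<and> norm v \<le> r} =
    pi * r\<^sup>2 - 4 * (r\<^sup>2 * arccos (1 / r) - sqrt (r\<^sup>2 - 1))"
proof -
  \<comment> \<open>The circle crosses the horizontal sides of the square at \<open>x = q\<close>
    and \<open>x = - q\<close>, where the minimum in \<open>m\<close> switches;
    \<open>r \<le> sqrt 2\<close> guarantees \<open>q \<le> 1\<close>.\<close>
  define q where "q = sqrt (r\<^sup>2 - 1)"
  define m where "m = (\<lambda>x. min 1 (sqrt (r\<^sup>2 - x\<^sup>2)))"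
  \<comment> \<open>An antiderivative of the full chord length of the circle.\<close>
  define H where "H = (\<lambda>x. x * sqrt (r\<^sup>2 - x\<^sup>2) + r\<^sup>2 * arcsin (x / r))"
  let ?A = "{v :: real \<times> real. v \<in> {-1..1} \<times> {-1..1} \<and> norm v \<le> r}"
  have r2: "1 < r\<^sup>2" "r\<^sup>2 \<le> 2"
    using r power_mono[of r "sqrt 2" 2] by (auto simp: power2_eq_square less_1_mult)
  have q: "0 \<le> q" "q\<^sup>2 = r\<^sup>2 - 1" "q \<le> 1"
    using r2 by (auto simp: q_def real_le_lsqrt)
  have H: "(H has_vector_derivative 2 * sqrt (r\<^sup>2 - x\<^sup>2)) (at x within S)"
    if x: "\<bar>x\<bar> \<le> 1" for x S
  proof -
    \<comment> \<open>As \<open>r > 1\<close>, the radicand is positive on all of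
      \<open>{-1..1}\<close>, so \<open>H\<close> is differentiable at the end points as
      well.\<close>
    have x2: "x\<^sup>2 < r\<^sup>2" using x r2 abs_square_le_1[of x] by linarith
    have "-1 < x / r" "x / r < 1" using x r by (auto simp: field_simps)
    have "(H has_real_derivative (sqrt (r\<^sup>2 - x\<^sup>2) + x * (- 2 * x * inverse (sqrt (r\<^sup>2 - x\<^sup>2)) / 2)
        + r\<^sup>2 * (inverse (sqrt (1 - (x / r)\<^sup>2)) * (1 / r)))) (at x within S)"
      unfolding H_def using x2 \<open>-1 < x / r\<close> \<open>x / r < 1\<close> r
      by (auto intro!: derivative_eq_intros simp: field_simps)
    moreover have "sqrt (1 - (x / r)\<^sup>2) = sqrt (r\<^sup>2 - x\<^sup>2) / r"
    proof -
      have "1 - (x / r)\<^sup>2 = (r\<^sup>2 - x\<^sup>2) / r\<^sup>2" using r by (simp add: field_simps power_divide)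
      then show ?thesis using r by (simp add: real_sqrt_divide)
    qed
    moreover have "sqrt (r\<^sup>2 - x\<^sup>2) + x * (- 2 * x * inverse (sqrt (r\<^sup>2 - x\<^sup>2)) / 2)
        + r\<^sup>2 * (inverse (sqrt (r\<^sup>2 - x\<^sup>2) / r) * (1 / r)) = 2 * sqrt (r\<^sup>2 - x\<^sup>2)"
    proof -
      define w where "w = sqrt (r\<^sup>2 - x\<^sup>2)"
      have w: "0 < w" "w\<^sup>2 = r\<^sup>2 - x\<^sup>2" using x2 by (auto simp: w_def)
      have "w + x * (- 2 * x * inverse w / 2) + r\<^sup>2 * (inverse (w / r) * (1 / r))
          = w + (r\<^sup>2 - x\<^sup>2) / w"
        using w(1) r by (simp add: field_simps power2_eq_square)
      also have "\<dots> = 2 * w" using w(1) unfolding w(2)[symmetric] by (simp add: power2_eq_square)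
      finally show ?thesis by (simp add: w_def)
    qed
    ultimately show ?thesis
      unfolding has_real_derivative_iff_has_vector_derivative[symmetric] by (simp only:)
  qed
  have m_out: "m x = sqrt (r\<^sup>2 - x\<^sup>2)" if "q \<le> \<bar>x\<bar>" for x
  proof -
    have "q\<^sup>2 \<le> x\<^sup>2" using that q(1) abs_le_square_iff[of q x] by simp
    then have "r\<^sup>2 - x\<^sup>2 \<le> 1" using q(2) by linarith
    then show ?thesis by (simp add: m_def min_def)
  qed
  have m_in: "m x = 1" if "\<bar>x\<bar> \<le> q" for x
  proof -
    have "x\<^sup>2 \<le> q\<^sup>2" using that q(1) abs_le_square_iff[of x q] by simp
    then show ?thesis using q(2) by (simp add: m_def min_def)
  qed
  have "((\<lambda>x. 2 * sqrt (r\<^sup>2 - x\<^sup>2)) has_integral (H (-q) - H (-1))) {-1..-q}"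
    using q by (intro fundamental_theorem_of_calculus H) auto
  then have i1: "((\<lambda>x. 2 * m x) has_integral (H (-q) - H (-1))) {-1..-q}"
    by (rule has_integral_eq[rotated]) (use q(1) in \<open>auto simp: m_out\<close>)
  have "((\<lambda>x. 2 * sqrt (r\<^sup>2 - x\<^sup>2)) has_integral (H 1 - H q)) {q..1}"
    using q by (intro fundamental_theorem_of_calculus H) auto
  then have i3: "((\<lambda>x. 2 * m x) has_integral (H 1 - H q)) {q..1}"
    by (rule has_integral_eq[rotated]) (use q(1) in \<open>auto simp: m_out\<close>)
  have "((\<lambda>x. 2) has_integral (2 * (q - (-q)))) {-q..q}"
    using has_integral_const_real[of "2::real" "-q" q] q by (simp add: mult.commute)
  then have i2: "((\<lambda>x. 2 * m x) has_integral (2 * (q - (-q)))) {-q..q}"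
    by (rule has_integral_eq[rotated]) (auto simp: m_in)
  have "((\<lambda>x. 2 * m x) has_integral (H (-q) - H (-1) + 2 * (q - (-q)))) {-1..q}"
    using q by (intro has_integral_combine[OF _ _ i1 i2]) auto
  then have I: "((\<lambda>x. 2 * m x) has_integral
      (H (-q) - H (-1) + 2 * (q - (-q)) + (H 1 - H q))) {-1..1}"
    using q by (intro has_integral_combine[OF _ _ _ i3]) auto
  \<comment> \<open>\<open>1\<close> and \<open>q\<close> are the legs of a right triangle with
    hypotenuse \<open>r\<close>, so the same angle has cosine \<open>1 / r\<close> and sine
    \<open>q / r\<close>.\<close>
  have aq: "arcsin (q / r) = arccos (1 / r)"
  proof -
    have "sin (arccos (1 / r)) = sqrt (1 - (1 / r)\<^sup>2)"
      using r by (intro sin_arccos) (auto simp: field_simps)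
    also have "1 - (1 / r)\<^sup>2 = (r\<^sup>2 - 1) / r\<^sup>2" using r by (simp add: field_simps power_divide)
    also have "sqrt \<dots> = q / r" using r by (simp add: real_sqrt_divide q_def)
    finally have "q / r = sin (arccos (1 / r))" by simp
    moreover have "0 \<le> arccos (1 / r)" "arccos (1 / r) \<le> pi / 2"
      using r arccos_lbound[of "1 / r"] arccos_le_pi2[of "1 / r"] by (auto simp: field_simps)
    ultimately show ?thesis using arcsin_sin[of "arccos (1 / r)"] by simp
  qed
  have a1: "arcsin (1 / r) = pi / 2 - arccos (1 / r)"
    using r arcsin_plus_arccos[of "1 / r"] by (simp add: field_simps)
  have neg: "H (- x) = - H x" if "\<bar>x\<bar> \<le> 1" for x
  proof -
    have "-1 \<le> x / r" "x / r \<le> 1" using that r by (auto simp: field_simps)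
    then show ?thesis by (simp add: H_def arcsin_minus)
  qed
  have "H 1 = q + r\<^sup>2 * (pi / 2 - arccos (1 / r))" by (simp add: H_def q_def[symmetric] a1)
  moreover have "H q = q + r\<^sup>2 * arccos (1 / r)" by (simp add: H_def q(2) aq)
  \<comment> \<open>\<open>H\<close> is odd, so the two outer pieces agree and the sum is
    \<open>2 * (H 1 - H q) + 4 * q\<close>.\<close>
  ultimately have val: "H (-q) - H (-1) + 2 * (q - (-q)) + (H 1 - H q)
      = pi * r\<^sup>2 - 4 * (r\<^sup>2 * arccos (1 / r) - sqrt (r\<^sup>2 - 1))"
    using neg[of q] neg[of 1] q by (simp add: q_def[symmetric] algebra_simps)
  have meas: "?A \<in> sets (lborel \<Otimes>\<^sub>M lborel)"
  proof -
    have "?A = ({-1..1} \<times> {-1..1}) \<inter> cball 0 r" by auto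
    then show ?thesis unfolding lborel_prod by (simp add: closed_Times borel_closed)
  qed
  have m_nonneg: "0 \<le> 2 * m x" if "x \<in> {-1..1}" for x
  proof -
    have "x\<^sup>2 \<le> 1" using that by (simp add: abs_square_le_1 abs_le_iff)
    then show ?thesis using r2 by (simp add: m_def)
  qed
  have slice: "emeasure lborel (Pair x -` ?A) = indicator {-1..1} x * ennreal (2 * m x)" for x
  proof (cases "x \<in> {-1..1}")
    case True
    then have x2: "x\<^sup>2 \<le> 1" by (simp add: abs_square_le_1 abs_le_iff)
    have mx: "0 \<le> m x" using x2 r2 by (simp add: m_def)
    have interval: "Pair x -` ?A = {- m x .. m x}"
    proof -
      have *: "sqrt (x\<^sup>2 + y\<^sup>2) \<le> r \<longleftrightarrow> \<bar>y\<bar> \<le> sqrt (r\<^sup>2 - x\<^sup>2)" for y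
      proof -
        have "sqrt (x\<^sup>2 + y\<^sup>2) \<le> r \<longleftrightarrow> x\<^sup>2 + y\<^sup>2 \<le> r\<^sup>2"
          using r by (metis real_sqrt_le_iff real_sqrt_unique less_eq_real_def order_less_trans zero_less_one)
        also have "\<dots> \<longleftrightarrow> sqrt (y\<^sup>2) \<le> sqrt (r\<^sup>2 - x\<^sup>2)"
          unfolding real_sqrt_le_iff by linarith
        finally show ?thesis by simp
      qed
      have "y \<in> Pair x -` ?A \<longleftrightarrow> y \<in> {- m x .. m x}" for y
      proof -
        have "y \<in> Pair x -` ?A \<longleftrightarrow> \<bar>y\<bar> \<le> 1 \<and> sqrt (x\<^sup>2 + y\<^sup>2) \<le> r"
          using True by (simp add: norm_Pair abs_le_iff conj_ac)
        also have "\<dots> \<longleftrightarrow> \<bar>y\<bar> \<le> m x" unfolding * m_def by (simp only: min.bounded_iff)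
        also have "\<dots> \<longleftrightarrow> y \<in> {- m x .. m x}" by (simp only: abs_le_iff atLeastAtMost_iff) linarith
        finally show ?thesis .
      qed
      then show ?thesis by blast
    qed
    show ?thesis unfolding interval using True mx by simp
  next
    case False
    then have empty: "Pair x -` ?A = {}" by auto
    show ?thesis unfolding empty using False by simp
  qed
  have "emeasure lborel ?A = (\<integral>\<^sup>+ x. emeasure lborel (Pair x -` ?A) \<partial>lborel)"
    using lborel.emeasure_pair_measure_alt[OF meas] by (simp add: lborel_prod)
  also have "\<dots> = (\<integral>\<^sup>+ x. indicator {-1..1} x * ennreal (2 * m x) \<partial>lborel)"
    by (simp only: slice)
  also have "\<dots> = (\<integral>\<^sup>+ x. ennreal (2 * m x) * indicator {-1..1} x \<partial>lborel)"
    by (simp add: mult.commute)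
  also have "\<dots> = ennreal (H (-q) - H (-1) + 2 * (q - (-q)) + (H 1 - H q))"
    by (rule nn_integral_has_integral_lebesgue'[OF m_nonneg I])
  finally show ?thesis
    unfolding measure_def using has_integral_nonneg[OF I m_nonneg] by (simp only: val enn2real_ennreal)
qed

text \<open>For \<open>r \<le> 1\<close> the disc lies inside the square. At \<open>r = 1\<close>
  the indicator is already 1, but the segment term vanishes there. Written with an indicator, this
  term later becomes the integral that starts at 1.\<close>

lemma square_disc_area:
  fixes r :: real
  assumes r: "0 \<le> r" "r \<le> sqrt 2"
  shows "measure lborel {v :: real \<times> real. v \<in> {-1..1} \<times> {-1..1} \<and> norm v \<le> r} =
    pi * r\<^sup>2 - 4 * (indicator {1..} r * (r\<^sup>2 * arccos (1 / r) - sqrt (r\<^sup>2 - 1)))"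
proof (cases "r \<le> 1")
  case True
  have "v \<in> {-1..1} \<times> {-1..1}" if "norm v \<le> r" for v :: "real \<times> real"
    using that True norm_fst_le[of "fst v" "snd v"] norm_snd_le[of "snd v" "fst v"]
    by (cases v) auto
  then have "{v :: real \<times> real. v \<in> {-1..1} \<times> {-1..1} \<and> norm v \<le> r} = cball 0 r" by auto
  moreover have "measure lborel (cball (0 :: real \<times> real) r) = pi * r\<^sup>2"
    using r by (simp add: content_cball unit_ball_vol_2 power2_eq_square)
  moreover have "indicator {1..} r * (r\<^sup>2 * arccos (1 / r) - sqrt (r\<^sup>2 - 1)) = 0"
    using True by (cases "r = 1") auto
  ultimately show ?thesis by simp
next
  case False
  then show ?thesis using square_disc_area_gt_one[of r] r by simp
qed

lemma square_outside_disc_area: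
  fixes r :: real
  assumes r: "0 \<le> r" "r \<le> sqrt 2"
  shows "measure lborel {v :: real \<times> real. v \<in> {-1..1} \<times> {-1..1} \<and> r < norm v} =
    4 - (pi * r\<^sup>2 - 4 * (indicator {1..} r * (r\<^sup>2 * arccos (1 / r) - sqrt (r\<^sup>2 - 1))))"
proof -
  let ?sq = "{-1..1} \<times> {-1..1} :: (real \<times> real) set"
  let ?A = "{v. v \<in> ?sq \<and> norm v \<le> r}"
  have sq: "?sq = cbox (-1, -1) (1, 1)" by (simp add: cbox_Pair_eq)
  have "?A = ?sq \<inter> cball 0 r" by auto
  then have A: "?A \<in> sets lborel" by (simp add: closed_Times borel_closed)
  have S: "?sq \<in> sets lborel" by (simp add: closed_Times borel_closed)
  have Sfin: "emeasure lborel ?sq \<noteq> \<infinity>"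
    unfolding sq using emeasure_lborel_cbox_finite less_imp_neq by blast
  have "measure lborel ?sq = 4" unfolding sq by (simp add: content_Pair)
  then have "measure lborel (?sq - ?A) = 4 - measure lborel ?A"
    using measure_Diff[OF Sfin S A] by auto
  moreover have "{v. v \<in> ?sq \<and> r < norm v} = ?sq - ?A" by auto
  ultimately show ?thesis by (simp add: square_disc_area[OF r])
qed

section \<open>The Rayleigh integral over the square\<close>

text \<open>Layer cake: \<open>1 - exp (- b * t\<^sup>2)\<close> is the integral of the Rayleigh density \<open>f\<close> over \<open>[0, t]\<close>.\<close>

lemma nn_integral_square_one_minus_exp:
  fixes b :: real and f :: "real \<Rightarrow> real"
  assumes b: "0 \<le> b" and f: "\<And>r. f r = 2 * b * r * exp (- b * r\<^sup>2)"
  defines "E \<equiv> (LBINT r:{0..sqrt 2}. (1 - pi / 4 * r\<^sup>2) * f r) +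
    (LBINT r:{1..sqrt 2}. (r\<^sup>2 * arccos (1 / r) - sqrt (r\<^sup>2 - 1)) * f r)"
  shows "(\<integral>\<^sup>+ v \<in> {-1..1} \<times> {-1..1}. ennreal (1 - exp (- b * (norm v)\<^sup>2)) \<partial>(lborel :: (real \<times> real) measure)) =
      ennreal (4 * E)" (is "?lhs = _")
    and "0 \<le> E"
proof -
  let ?sq = "{-1..1} \<times> {-1..1} :: (real \<times> real) set"
  define g where "g = (\<lambda>r. (1 - pi / 4 * r\<^sup>2) * f r)"
  define h where "h = (\<lambda>r. (r\<^sup>2 * arccos (1 / r) - sqrt (r\<^sup>2 - 1)) * f r)"
  have f': "f = (\<lambda>r. 2 * b * r * exp (- b * r\<^sup>2))" using f by auto
  have [measurable]: "f \<in> borel_measurable borel" unfolding f' by measurable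
  have [measurable]: "?sq \<in> sets (borel :: (real \<times> real) measure)"
    by (simp add: closed_Times borel_closed)
  have f_nonneg: "0 \<le> f r" if "0 \<le> r" for r using that b by (simp add: f)
  \<comment> \<open>The interval is half-open so that \<open>r\<close> ranges over
    \<open>r < norm v\<close>, which for fixed \<open>r\<close> describes the outside of the closed
    disc; the omitted end point is a null set.\<close>
  have FTC: "ennreal (1 - exp (- b * t\<^sup>2)) = (\<integral>\<^sup>+ r \<in> {0..<t}. ennreal (f r) \<partial>lborel)"
    if t: "0 \<le> t" for t
  proof -
    have "(\<integral>\<^sup>+ r \<in> {0..t}. ennreal (f r) \<partial>lborel) = ennreal (- exp (- b * t\<^sup>2) - - exp (- b * 0\<^sup>2))"
      using t by (intro nn_integral_FTC_Icc)
        (auto intro!: derivative_eq_intros simp: f b)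
    moreover have "(\<integral>\<^sup>+ r \<in> {0..t}. ennreal (f r) \<partial>lborel) = (\<integral>\<^sup>+ r \<in> {0..<t}. ennreal (f r) \<partial>lborel)"
      using AE_lborel_singleton[of t]
      by (intro nn_integral_cong_AE) (auto split: split_indicator)
    ultimately show ?thesis by simp
  qed
  \<comment> \<open>\<open>F\<close> merges the two integrals of \<open>E\<close> into one
    integrand. Its description as \<open>f r\<close> times the area outside the disc shows that it
    is nonnegative and lets it match the outcome of Fubini.\<close>
  define F where "F = (\<lambda>r. indicator {0..sqrt 2} r *\<^sub>R (4 * g r) + indicator {1..sqrt 2} r *\<^sub>R (4 * h r))"
  have F: "F r = indicator {0..sqrt 2} r * (f r * measure lborel {v \<in> ?sq. r < norm v})" for r
    by (cases "r \<in> {0..sqrt 2}")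
      (auto simp: F_def g_def h_def square_outside_disc_area algebra_simps split: split_indicator)
  \<comment> \<open>The corners are at distance \<open>sqrt 2\<close>, so cutting the range of
    \<open>r\<close> there loses nothing.\<close>
  have norm_sq: "norm v \<le> sqrt 2" if "v \<in> ?sq" for v
  proof -
    obtain x y where v: "v = (x, y)" by (cases v)
    have "x\<^sup>2 \<le> 1" "y\<^sup>2 \<le> 1" using that v by (auto simp: abs_square_le_1 abs_le_iff)
    then show ?thesis by (simp add: v norm_Pair)
  qed
  have "(\<integral>\<^sup>+ v \<in> ?sq. ennreal (1 - exp (- b * (norm v)\<^sup>2)) \<partial>lborel) =
    (\<integral>\<^sup>+ v. (\<integral>\<^sup>+ r. ennreal (f r) * indicator {0..sqrt 2} r * indicator {v \<in> ?sq. r < norm v} v \<partial>lborel) \<partial>lborel)"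
  proof (intro nn_integral_cong)
    fix v :: "real \<times> real"
    show "ennreal (1 - exp (- b * (norm v)\<^sup>2)) * indicator ?sq v =
      (\<integral>\<^sup>+ r. ennreal (f r) * indicator {0..sqrt 2} r * indicator {v \<in> ?sq. r < norm v} v \<partial>lborel)"
      unfolding FTC[OF norm_ge_zero]
      using norm_sq[of v] by (subst nn_integral_multc[symmetric])
        (auto intro!: nn_integral_cong split: split_indicator)
  qed
  \<comment> \<open>After the exchange, the inner integral over \<open>v\<close> is the area of the
    part of the square outside the disc of radius \<open>r\<close>.\<close>
  also have "\<dots> = (\<integral>\<^sup>+ r. (\<integral>\<^sup>+ v. ennreal (f r) * indicator {0..sqrt 2} r * indicator {v \<in> ?sq. r < norm v} v \<partial>lborel) \<partial>lborel)"
    by (rule lborel_pair.Fubini') measurable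
  also have "\<dots> = (\<integral>\<^sup>+ r. ennreal (F r) \<partial>lborel)"
  proof (intro nn_integral_cong)
    fix r :: real
    have "{v \<in> ?sq. r < norm v} \<in> sets lborel" by measurable
    moreover have "emeasure lborel {v \<in> ?sq. r < norm v} < \<infinity>"
      by (rule emeasure_bounded_finite, rule bounded_subset[of ?sq]) (auto intro: bounded_Times)
    ultimately show "(\<integral>\<^sup>+ v. ennreal (f r) * indicator {0..sqrt 2} r * indicator {v \<in> ?sq. r < norm v} v \<partial>lborel) =
      ennreal (F r)"
      using f_nonneg[of r]
      by (cases "r \<in> {0..sqrt 2}")
        (simp_all add: F nn_integral_cmult_indicator emeasure_eq_ennreal_measure ennreal_mult' less_top)
  qed
  finally have lhs: "?lhs = (\<integral>\<^sup>+ r. ennreal (F r) \<partial>lborel)" .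
  have "continuous_on {0..sqrt 2} (\<lambda>r. 4 * g r)"
    unfolding g_def f' by (intro continuous_intros)
  then have ig: "set_integrable lborel {0..sqrt 2} (\<lambda>r. 4 * g r)"
    by (rule borel_integrable_atLeastAtMost')
  have "continuous_on {1..sqrt 2} (\<lambda>r. 4 * h r)"
    unfolding h_def f' by (intro continuous_intros) (auto simp: field_simps)
  then have ih: "set_integrable lborel {1..sqrt 2} (\<lambda>r. 4 * h r)"
    by (rule borel_integrable_atLeastAtMost')
  have int: "integrable lborel F"
    using ig ih unfolding F_def set_integrable_def by (rule Bochner_Integration.integrable_add)
  have F_nonneg: "0 \<le> F r" for r using f_nonneg[of r] by (simp add: F split: split_indicator)
  have "integral\<^sup>L lborel F = (LBINT r:{0..sqrt 2}. 4 * g r) + (LBINT r:{1..sqrt 2}. 4 * h r)"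
    using ig ih unfolding F_def set_integrable_def set_lebesgue_integral_def
    by (rule Bochner_Integration.integral_add)
  then have E: "integral\<^sup>L lborel F = 4 * E"
    by (simp add: E_def g_def h_def distrib_left mult.assoc)
  show "?lhs = ennreal (4 * E)"
    unfolding lhs E[symmetric] using int F_nonneg by (intro nn_integral_eq_integral) auto
  have "0 \<le> integral\<^sup>L lborel F" using F_nonneg by (rule Bochner_Integration.integral_nonneg)
  then show "0 \<le> E" by (simp add: E)
qed

section \<open>Distance from the origin to a point configuration\<close>

text \<open>With values in \<open>ennreal\<close> the infimum over an empty configuration is
  infinite, so empty Poisson configurations fit into the same comparisons.\<close>

definition nearest_distance :: "plane set \<Rightarrow> ennreal" where
  "nearest_distance S = (INF x\<in>S. ennreal (norm x))"

lemma nearest_distance_less_iff: "nearest_distance S < t \<longleftrightarrow> (\<exists>x\<in>S. ennreal (norm x) < t)"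
  by (simp add: nearest_distance_def INF_less_iff)

lemma nearest_distance_empty [simp]: "nearest_distance {} = \<top>"
  by (simp add: nearest_distance_def)

text \<open>Any point \<open>z\<close> of \<open>S\<close> confines the search to the closed disc of
  radius \<open>norm z\<close>, which contains only finitely many points of
  \<open>S\<close>.\<close>

lemma nearest_distance_attained:
  assumes "locally_finite S" and "S \<noteq> {}"
  obtains x where "x \<in> S" "nearest_distance S = ennreal (norm x)" "\<And>y. y \<in> S \<Longrightarrow> norm x \<le> norm y"
proof -
  obtain z where z: "z \<in> S" using assms(2) by auto
  let ?A = "S \<inter> cball 0 (norm z)"
  have "finite (norm ` ?A)" "norm ` ?A \<noteq> {}"
    using assms(1) z by (auto simp: locally_finite_def)
  from Min_in[OF this] obtain x where x: "x \<in> ?A" "norm x = Min (norm ` ?A)" by auto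
  have min: "norm x \<le> norm y" if "y \<in> S" for y
  proof (cases "y \<in> ?A")
    case True
    then show ?thesis using x(2) \<open>finite (norm ` ?A)\<close> by simp
  next
    case False
    then show ?thesis using that x(1) by auto
  qed
  have "nearest_distance S = ennreal (norm x)"
    unfolding nearest_distance_def using x(1) min
    by (intro antisym INF_lower2[of x] INF_greatest) (auto intro: ennreal_leI)
  with x(1) min show thesis by (intro that) auto
qed

lemma space_config_space [simp]: "space config_space = Collect locally_finite"
  unfolding config_space_def by (rule space_measure_of) auto

lemma sets_config_space_card:
  assumes "B \<in> sets borel" "bounded B"
  shows "{S. locally_finite S \<and> card (S \<inter> B) = k} \<in> sets config_space"
  unfolding config_space_def using assms by (subst sets_measure_of) (auto intro!: sigma_sets.Basic)

text \<open>The sigma-algebra is generated by counts in bounded sets, whereas the set of points at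
  distance below \<open>y\<close> is the whole plane for infinite \<open>y\<close>. It is therefore
  exhausted by the bounded sets \<open>B n\<close>, and the distance is below \<open>y\<close>
  exactly when one of them has a nonzero count.\<close>

lemma nearest_distance_measurable [measurable]: "nearest_distance \<in> borel_measurable config_space"
proof (rule borel_measurableI_less)
  fix y :: ennreal
  define B where "B = (\<lambda>n. {x :: plane. norm x < real n \<and> ennreal (norm x) < y})"
  have B: "B n \<in> sets borel" "bounded (B n)" for n
    by (simp_all add: B_def) (rule bounded_subset[of "ball 0 (real n)"], auto)
  have hit: "nearest_distance S < y \<longleftrightarrow> (\<exists>n. card (S \<inter> B n) \<noteq> 0)" if "locally_finite S" for S
  proof -
    \<comment> \<open>\<open>card\<close> is 0 on infinite sets too; finiteness makes a nonzero
      count equivalent to a hit.\<close>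
    have "finite (S \<inter> B n)" for n using that B(2) by (simp add: locally_finite_def)
    moreover have "ennreal (norm x) < y \<longleftrightarrow> (\<exists>n. x \<in> B n)" for x
      using reals_Archimedean2[of "norm x"] by (auto simp: B_def)
    ultimately show ?thesis by (auto simp: nearest_distance_less_iff)
  qed
  have "{S \<in> space config_space. nearest_distance S < y}
      = (\<Union>n. space config_space - {S. locally_finite S \<and> card (S \<inter> B n) = 0})"
    by (auto simp: hit)
  also have "\<dots> \<in> sets config_space"
    using B by (intro sets.countable_UN sets.compl_sets sets_config_space_card image_subsetI)
  finally show "{S \<in> space config_space. nearest_distance S < y} \<in> sets config_space" .
qed

section \<open>Association as a comparison of distances\<close>

text \<open>Away from the origin both powers are real quotients, and taking roots of order \<alpha>
  gives the claim. A station at the origin has infinite received power and is treated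
  separately.\<close>

lemma received_power_le_iff:
  assumes "0 < a" "0 < b" "0 < \<alpha>"
  shows "received_power \<alpha> (Y, b) \<le> received_power \<alpha> (X, a) \<longleftrightarrow>
    norm X \<le> (a / b) powr (1 / \<alpha>) * norm Y"
proof (cases "X = 0 \<or> Y = 0")
  case True
  then show ?thesis using assms
    by (auto simp: received_power_def divide_ennreal top_unique
        ennreal_divide_eq_top_iff ennreal_divide_self)
next
  case False
  define c where "c = (a / b) powr (1 / \<alpha>)"
  have pos: "0 < norm X" "0 < norm Y" "0 < norm X powr \<alpha>" "0 < norm Y powr \<alpha>" "0 < c"
    using False assms by (auto simp: c_def)
  have "c powr \<alpha> = a / b" using assms by (simp add: c_def powr_powr)
  then have cY: "(c * norm Y) powr \<alpha> = a / b * norm Y powr \<alpha>"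
    using pos by (simp add: powr_mult)
  have "received_power \<alpha> (Y, b) \<le> received_power \<alpha> (X, a)
      \<longleftrightarrow> b / norm Y powr \<alpha> \<le> a / norm X powr \<alpha>"
    using assms pos by (simp add: received_power_def divide_ennreal ennreal_le_iff)
  also have "\<dots> \<longleftrightarrow> norm X powr \<alpha> \<le> (c * norm Y) powr \<alpha>"
    unfolding cY using assms pos by (simp add: field_simps)
  also have "\<dots> \<longleftrightarrow> norm X \<le> c * norm Y"
    using powr_mono2[of \<alpha> "norm X" "c * norm Y"] powr_less_mono2[of \<alpha> "c * norm Y" "norm X"] assms pos
    by (auto simp: not_le[symmetric])
  finally show ?thesis by (simp add: c_def)
qed

text \<open>Between stations of the same kind the power ratio is 1, which leaves a bare comparison
  of norms.\<close>

lemma serves_origin_iff: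
  assumes "0 < a" "0 < b" "0 < \<alpha>" "X \<in> P"
    and S: "S = P \<times> {a} \<union> Q \<times> {b}"
  shows "serves_origin \<alpha> S (X, a) \<longleftrightarrow>
    (\<forall>Y\<in>P. norm X \<le> norm Y) \<and> (\<forall>Y\<in>Q. norm X \<le> (a / b) powr (1 / \<alpha>) * norm Y)"
proof -
  have "serves_origin \<alpha> S (X, a) \<longleftrightarrow> (\<forall>z\<in>S. received_power \<alpha> z \<le> received_power \<alpha> (X, a))"
    using assms(4) by (auto simp: serves_origin_def is_arg_max_def S not_less)
  also have "\<dots> \<longleftrightarrow> (\<forall>Y\<in>P. received_power \<alpha> (Y, a) \<le> received_power \<alpha> (X, a)) \<and>
      (\<forall>Y\<in>Q. received_power \<alpha> (Y, b) \<le> received_power \<alpha> (X, a))"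
    unfolding S by blast
  finally show ?thesis using assms(1-3) by (simp add: received_power_le_iff)
qed

text \<open>Only a nearest point of each configuration matters. A maximiser need not be unique,
  hence the non-strict inequality, and an empty \<open>Q\<close> makes the right-hand side infinite.
  The two configurations are arbitrary, so Poisson and grid points can take either role.\<close>

lemma some_serves_origin_iff:
  assumes "0 < a" "0 < b" "0 < \<alpha>" and P: "locally_finite P" "P \<noteq> {}" and Q: "locally_finite Q"
    and S: "S = P \<times> {a} \<union> Q \<times> {b}"
  shows "(\<exists>X\<in>P. serves_origin \<alpha> S (X, a)) \<longleftrightarrow>
    nearest_distance P \<le> ennreal ((a / b) powr (1 / \<alpha>)) * nearest_distance Q"
proof -
  define c where "c = (a / b) powr (1 / \<alpha>)"
  have c: "0 < c" using assms by (simp add: c_def)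
  obtain x where x: "x \<in> P" "nearest_distance P = ennreal (norm x)" "\<And>y. y \<in> P \<Longrightarrow> norm x \<le> norm y"
    using nearest_distance_attained[OF P] by blast
  have "(\<exists>X\<in>P. serves_origin \<alpha> S (X, a)) \<longleftrightarrow> (\<forall>Y\<in>Q. norm x \<le> c * norm Y)"
  proof -
    have *: "serves_origin \<alpha> S (X, a) \<longleftrightarrow> (\<forall>Y\<in>P. norm X \<le> norm Y) \<and> (\<forall>Y\<in>Q. norm X \<le> c * norm Y)"
      if "X \<in> P" for X
      unfolding c_def by (rule serves_origin_iff[OF assms(1-3) that S])
    show ?thesis
      using x(1,3) * by (meson order_trans)
  qed
  also have "\<dots> \<longleftrightarrow> nearest_distance P \<le> ennreal c * nearest_distance Q"
  proof (cases "Q = {}")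
    case True
    then show ?thesis using c by (simp add: ennreal_mult_top)
  next
    case False
    obtain y where y: "y \<in> Q" "nearest_distance Q = ennreal (norm y)" "\<And>z. z \<in> Q \<Longrightarrow> norm y \<le> norm z"
      using nearest_distance_attained[OF Q False] by blast
    have "(\<forall>Y\<in>Q. norm x \<le> c * norm Y) \<longleftrightarrow> norm x \<le> c * norm y"
      using y(1,3) c by (meson mult_left_mono less_imp_le order_trans)
    then show ?thesis using c by (simp add: x y ennreal_mult[symmetric])
  qed
  finally show ?thesis by (simp add: c_def)
qed

section \<open>The nearest point of the shifted grid\<close>

lemma square_grid_nonempty: "square_grid s u \<noteq> {}"
  by (auto simp: square_grid_def)

text \<open>Each coordinate can be treated alone: a nonzero grid index moves it by at least
  \<open>s\<close>, twice the largest modulus it can have, so its modulus cannot decrease.\<close>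

lemma nearest_distance_square_grid:
  assumes u: "u \<in> {- s / 2 .. s / 2} \<times> {- s / 2 .. s / 2}"
  shows "nearest_distance (square_grid s u) = ennreal (norm u)"
proof -
  have far: "t\<^sup>2 \<le> (s * of_int k + t)\<^sup>2" if "- s / 2 \<le> t" "t \<le> s / 2" for t :: real and k :: int
  proof -
    have s: "0 \<le> s" using that by simp
    consider "k = 0" | "1 \<le> k" | "k \<le> -1" by linarith
    then have "\<bar>t\<bar> \<le> \<bar>s * of_int k + t\<bar>"
    proof cases
      case 2
      then have "s * 1 \<le> s * of_int k" using s by (intro mult_left_mono) auto
      then show ?thesis using that by linarith
    next
      case 3
      then have "s * of_int k \<le> s * (-1)" using s by (intro mult_left_mono) auto
      then show ?thesis using that by linarith
    qed simp
    then show ?thesis by (simp add: abs_le_square_iff)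
  qed
  have "u \<in> square_grid s u"
    unfolding square_grid_def by (rule CollectI, rule exI[of _ 0], rule exI[of _ 0]) simp
  moreover have "norm u \<le> norm x" if "x \<in> square_grid s u" for x
    using that u far by (cases u) (auto simp: square_grid_def norm_Pair intro!: add_mono)
  ultimately show ?thesis
    unfolding nearest_distance_def
    by (intro antisym INF_lower2[of u] INF_greatest) (auto intro: ennreal_leI)
qed

section \<open>Void probabilities of the Poisson process\<close>

text \<open>This is the complement of the count law at \<open>k = 0\<close>; local finiteness
  excludes that the count is 0 because the intersection is infinite.\<close>

lemma poisson_process_hit:
  assumes "prob_space M" and PP: "poisson_process M lam \<Phi>" and B: "B \<in> sets borel" "bounded B"
  shows "emeasure M {\<omega> \<in> space M. \<exists>x\<in>\<Phi> \<omega>. x \<in> B} = ennreal (1 - exp (- (lam * measure lborel B)))"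
proof -
  interpret prob_space M by fact
  have \<Phi>[measurable]: "\<Phi> \<in> measurable M config_space"
    and void: "prob {\<omega> \<in> space M. card (\<Phi> \<omega> \<inter> B) = 0} = exp (- (lam * measure lborel B))"
    using PP B by (auto simp: poisson_process_def)
  have lf: "locally_finite (\<Phi> \<omega>)" if "\<omega> \<in> space M" for \<omega>
    using measurable_space[OF \<Phi> that] by simp
  have "{\<omega> \<in> space M. card (\<Phi> \<omega> \<inter> B) = 0}
      = \<Phi> -` {S. locally_finite S \<and> card (S \<inter> B) = 0} \<inter> space M"
    using lf by auto
  then have "{\<omega> \<in> space M. card (\<Phi> \<omega> \<inter> B) = 0} \<in> events"
    using measurable_sets[OF \<Phi> sets_config_space_card[OF B, of 0]] by (simp only:)
  from prob_compl[OF this]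
  have "prob (space M - {\<omega> \<in> space M. card (\<Phi> \<omega> \<inter> B) = 0}) = 1 - exp (- (lam * measure lborel B))"
    by (simp add: void)
  moreover have "space M - {\<omega> \<in> space M. card (\<Phi> \<omega> \<inter> B) = 0} = {\<omega> \<in> space M. \<exists>x\<in>\<Phi> \<omega>. x \<in> B}"
    using lf B(2) by (auto simp: locally_finite_def card_gt_0_iff)
  ultimately show ?thesis by (simp add: emeasure_eq_measure)
qed

text \<open>The two events say that the closed, respectively open, disc is hit, and both discs have
  area \<open>pi * t\<^sup>2\<close>. The closed case relies on the infimum being attained.\<close>

lemma poisson_process_nearest_distance:
  assumes M: "prob_space M" and PP: "poisson_process M lam \<Phi>" and t: "0 \<le> t"
  shows "emeasure M {\<omega> \<in> space M. nearest_distance (\<Phi> \<omega>) \<le> ennreal t} = ennreal (1 - exp (- (lam * pi * t\<^sup>2)))"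
    and "emeasure M {\<omega> \<in> space M. nearest_distance (\<Phi> \<omega>) < ennreal t} = ennreal (1 - exp (- (lam * pi * t\<^sup>2)))"
proof -
  have \<Phi>: "\<Phi> \<in> measurable M config_space" using PP by (simp add: poisson_process_def)
  have "nearest_distance (\<Phi> \<omega>) \<le> ennreal t \<longleftrightarrow> (\<exists>x\<in>\<Phi> \<omega>. x \<in> cball 0 t)" if "\<omega> \<in> space M" for \<omega>
  proof (cases "\<Phi> \<omega> = {}")
    case False
    have "locally_finite (\<Phi> \<omega>)" using measurable_space[OF \<Phi> that] by simp
    from nearest_distance_attained[OF this False] show ?thesis
      using t by (metis ennreal_le_iff mem_cball_0 order_trans)
  qed (simp add: top_unique)
  then have "{\<omega> \<in> space M. nearest_distance (\<Phi> \<omega>) \<le> ennreal t} = {\<omega> \<in> space M. \<exists>x\<in>\<Phi> \<omega>. x \<in> cball 0 t}"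
    by auto
  then show "emeasure M {\<omega> \<in> space M. nearest_distance (\<Phi> \<omega>) \<le> ennreal t} = ennreal (1 - exp (- (lam * pi * t\<^sup>2)))"
    using poisson_process_hit[OF M PP, of "cball 0 t"] t
    by (simp add: content_cball unit_ball_vol_2 power2_eq_square mult.assoc)
  have "{\<omega> \<in> space M. nearest_distance (\<Phi> \<omega>) < ennreal t} = {\<omega> \<in> space M. \<exists>x\<in>\<Phi> \<omega>. x \<in> ball 0 t}"
    by (auto simp: nearest_distance_less_iff ennreal_less_iff)
  then show "emeasure M {\<omega> \<in> space M. nearest_distance (\<Phi> \<omega>) < ennreal t} = ennreal (1 - exp (- (lam * pi * t\<^sup>2)))"
    using poisson_process_hit[OF M PP, of "ball 0 t"] t
    by (simp add: content_ball unit_ball_vol_2 power2_eq_square mult.assoc)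
qed

section \<open>Integration against independent and uniform laws\<close>

text \<open>The joint law is a product, so Fubini applies: the value of \<open>X\<close> is frozen
  at \<open>\<omega>\<close> while \<open>Y\<close> is sampled at a fresh
  \<open>\<omega>'\<close>.\<close>

lemma (in prob_space) emeasure_indep_var_Collect:
  assumes ind: "indep_var S X T Y" and P: "{z \<in> space (S \<Otimes>\<^sub>M T). P (fst z) (snd z)} \<in> sets (S \<Otimes>\<^sub>M T)"
  shows "emeasure M {\<omega> \<in> space M. P (X \<omega>) (Y \<omega>)} =
    (\<integral>\<^sup>+ \<omega>. emeasure M {\<omega>' \<in> space M. P (X \<omega>) (Y \<omega>')} \<partial>M)"
proof -
  have [measurable]: "random_variable S X" "random_variable T Y"
    and eq: "distr M S X \<Otimes>\<^sub>M distr M T Y = distr M (S \<Otimes>\<^sub>M T) (\<lambda>\<omega>. (X \<omega>, Y \<omega>))"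
    using ind by (auto simp: indep_var_distribution_eq)
  let ?A = "{z \<in> space (S \<Otimes>\<^sub>M T). P (fst z) (snd z)}"
  interpret Y: prob_space "distr M T Y" by (rule prob_space_distr) measurable
  have P': "?A \<in> sets (distr M S X \<Otimes>\<^sub>M distr M T Y)" using P by simp
  have slice: "Pair x -` ?A \<in> sets T" for x
    using sets_Pair1[OF P] .
  have "{\<omega> \<in> space M. P (X \<omega>) (Y \<omega>)} = (\<lambda>\<omega>. (X \<omega>, Y \<omega>)) -` ?A \<inter> space M"
    using measurable_space[OF \<open>random_variable S X\<close>] measurable_space[OF \<open>random_variable T Y\<close>]
    by (auto simp: space_pair_measure)
  then have "emeasure M {\<omega> \<in> space M. P (X \<omega>) (Y \<omega>)}
      = emeasure (distr M (S \<Otimes>\<^sub>M T) (\<lambda>\<omega>. (X \<omega>, Y \<omega>))) ?A"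
    using P by (simp add: emeasure_distr)
  also have "\<dots> = (\<integral>\<^sup>+ x. emeasure (distr M T Y) (Pair x -` ?A) \<partial>distr M S X)"
    unfolding eq[symmetric] by (rule Y.emeasure_pair_measure_alt[OF P'])
  also have "\<dots> = (\<integral>\<^sup>+ \<omega>. emeasure (distr M T Y) (Pair (X \<omega>) -` ?A) \<partial>M)"
    using Y.measurable_emeasure_Pair[OF P'] by (subst nn_integral_distr) auto
  also have "\<dots> = (\<integral>\<^sup>+ \<omega>. emeasure M {\<omega>' \<in> space M. P (X \<omega>) (Y \<omega>')} \<partial>M)"
  proof (rule nn_integral_cong)
    fix \<omega> assume "\<omega> \<in> space M"
    then have "Y -` (Pair (X \<omega>) -` ?A) \<inter> space M = {\<omega>' \<in> space M. P (X \<omega>) (Y \<omega>')}"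
      using measurable_space[OF \<open>random_variable S X\<close>] measurable_space[OF \<open>random_variable T Y\<close>]
      by (auto simp: space_pair_measure)
    then show "emeasure (distr M T Y) (Pair (X \<omega>) -` ?A) = emeasure M {\<omega>' \<in> space M. P (X \<omega>) (Y \<omega>')}"
      using slice by (simp add: emeasure_distr)
  qed
  finally show ?thesis .
qed

text \<open>Substituting \<open>u = (s / 2) *\<^sub>R v\<close> gives the Jacobian
  \<open>s\<^sup>2 / 4\<close>; dividing by the cell area \<open>s\<^sup>2\<close> leaves the factor
  \<open>1 / 4\<close>.\<close>

lemma nn_integral_uniform_square:
  fixes g :: "real \<times> real \<Rightarrow> ennreal"
  assumes [measurable]: "g \<in> borel_measurable borel" and s: "0 < s"
  shows "(\<integral>\<^sup>+ u. g u \<partial>uniform_measure lborel ({- s / 2 .. s / 2} \<times> {- s / 2 .. s / 2})) =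
    (\<integral>\<^sup>+ v \<in> {-1..1} \<times> {-1..1}. g ((s / 2) *\<^sub>R v) \<partial>lborel) / 4"
proof -
  define Q where "Q = {- s / 2 .. s / 2} \<times> {- s / 2 .. s / 2}"
  let ?sq = "{-1..1} \<times> {-1..1} :: (real \<times> real) set"
  have [measurable]: "Q \<in> sets borel" "?sq \<in> sets borel" by (simp_all add: Q_def closed_Times borel_closed)
  have emeasure_Q: "emeasure lborel Q = ennreal (s\<^sup>2)"
  proof -
    have "emeasure (lborel \<Otimes>\<^sub>M lborel) Q = ennreal s * ennreal s"
      using s unfolding Q_def by (subst lborel.emeasure_pair_measure_Times) auto
    then show ?thesis using s by (simp add: lborel_prod ennreal_mult[symmetric] power2_eq_square)
  qed
  have scale: "(s / 2) *\<^sub>R v \<in> Q \<longleftrightarrow> v \<in> ?sq" for v :: "real \<times> real"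
  proof -
    have "- s / 2 \<le> s / 2 * t \<longleftrightarrow> -1 \<le> t" "s / 2 * t \<le> s / 2 \<longleftrightarrow> t \<le> 1" for t
      using s mult_le_cancel_left_pos[of "s / 2" "-1" t] mult_le_cancel_left_pos[of "s / 2" t 1]
      by simp_all
    then show ?thesis unfolding Q_def by (cases v) simp
  qed
  have "(\<integral>\<^sup>+ u \<in> Q. g u \<partial>lborel) = (\<integral>\<^sup>+ u \<in> Q. g u \<partial>density (distr lborel borel (\<lambda>v. 0 + (s / 2) *\<^sub>R v)) (\<lambda>_. ennreal (\<bar>s / 2\<bar> ^ DIM(real \<times> real))))"
    using s by (subst lborel_affine[of "s / 2" 0]) simp_all
  also have "\<dots> = (\<integral>\<^sup>+ v. ennreal (s\<^sup>2 / 4) * (g ((s / 2) *\<^sub>R v) * indicator Q ((s / 2) *\<^sub>R v)) \<partial>lborel)"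
    using s by (simp add: nn_integral_density nn_integral_distr power2_eq_square)
  also have "\<dots> = ennreal (s\<^sup>2 / 4) * (\<integral>\<^sup>+ v \<in> ?sq. g ((s / 2) *\<^sub>R v) \<partial>lborel)"
    by (subst nn_integral_cmult) (auto simp: indicator_def scale simp del: mem_Times_iff)
  finally have *: "(\<integral>\<^sup>+ u \<in> Q. g u \<partial>lborel) = ennreal (s\<^sup>2 / 4) * (\<integral>\<^sup>+ v \<in> ?sq. g ((s / 2) *\<^sub>R v) \<partial>lborel)" .
  have "ennreal (s\<^sup>2 / 4) / ennreal (s\<^sup>2) = 1 / 4"
  proof -
    have "ennreal (s\<^sup>2 / 4) / ennreal (s\<^sup>2) = ennreal (1 / 4)"
      using s by (subst divide_ennreal) auto
    also have "\<dots> = 1 / 4" by (subst divide_ennreal[symmetric]) auto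
    finally show ?thesis .
  qed
  then have "ennreal (s\<^sup>2 / 4) * x / ennreal (s\<^sup>2) = x / 4" for x
    by (metis ennreal_times_divide mult.commute mult.right_neutral)
  then show ?thesis
    unfolding Q_def[symmetric] by (simp add: nn_integral_uniform_measure emeasure_Q *)
qed

section \<open>Association probabilities of the two kinds of station\<close>

theorem theorem1:
  fixes M :: "'w measure"
    and \<Phi>\<^sub>g \<Phi>\<^sub>p :: "'w \<Rightarrow> plane set"
    and lam\<^sub>g lam\<^sub>p p\<^sub>g p\<^sub>p \<alpha> \<rho> \<eta> :: real
    and f :: "real \<Rightarrow> real"
  assumes "prob_space M"
    and "lam\<^sub>g > 0" and "lam\<^sub>p > 0" and "p\<^sub>g > 0" and "p\<^sub>p > 0" and "\<alpha> > 2"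
    and "random_shifted_grid M lam\<^sub>g \<Phi>\<^sub>g"
    and "poisson_process M lam\<^sub>p \<Phi>\<^sub>p"
    and "prob_space.indep_var M config_space \<Phi>\<^sub>g config_space \<Phi>\<^sub>p"
    and "\<rho> = lam\<^sub>p / lam\<^sub>g" and "\<eta> = p\<^sub>p / p\<^sub>g"
    and "\<And>r. f r = 2 * pi * (\<rho> * \<eta> powr (2 / \<alpha>) / 4) * r *
                exp (- pi * (\<rho> * \<eta> powr (2 / \<alpha>) / 4) * r\<^sup>2)"
  shows "measure M (assoc_event_poisson M \<alpha> p\<^sub>g p\<^sub>p \<Phi>\<^sub>g \<Phi>\<^sub>p) =
           (LBINT r:{0..sqrt 2}. (1 - pi / 4 * r\<^sup>2) * f r) +
           (LBINT r:{1..sqrt 2}. (r\<^sup>2 * arccos (1 / r) - sqrt (r\<^sup>2 - 1)) * f r)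
       \<and> measure M (assoc_event_grid M \<alpha> p\<^sub>g p\<^sub>p \<Phi>\<^sub>g \<Phi>\<^sub>p) =
           1 - measure M (assoc_event_poisson M \<alpha> p\<^sub>g p\<^sub>p \<Phi>\<^sub>g \<Phi>\<^sub>p)"
proof -
  interpret prob_space M by fact
  define s where "s = 1 / sqrt lam\<^sub>g"
  have s: "0 < s" "s\<^sup>2 = 1 / lam\<^sub>g" using assms(2) by (auto simp: s_def power_divide)
  let ?Q = "{- s / 2 .. s / 2} \<times> {- s / 2 .. s / 2} :: plane set"
  obtain U where U[measurable]: "U \<in> borel_measurable M"
    and dU: "distr M borel U = uniform_measure lborel ?Q"
    and grid: "\<And>\<omega>. \<omega> \<in> space M \<Longrightarrow> \<Phi>\<^sub>g \<omega> = square_grid s (U \<omega>)"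
    using assms(7) unfolding random_shifted_grid_def Let_def s_def by blast
  have \<Phi>[measurable]: "\<Phi>\<^sub>g \<in> measurable M config_space" "\<Phi>\<^sub>p \<in> measurable M config_space"
    using assms(9) by (auto simp: indep_var_distribution_eq)
  have lf: "locally_finite (\<Phi>\<^sub>g \<omega>)" "locally_finite (\<Phi>\<^sub>p \<omega>)" if "\<omega> \<in> space M" for \<omega>
    using \<Phi>[THEN measurable_space, OF that] by auto
  define R where "R = (\<lambda>\<omega>. nearest_distance (\<Phi>\<^sub>g \<omega>))"
  define R' where "R' = (\<lambda>\<omega>. nearest_distance (\<Phi>\<^sub>p \<omega>))"
  have [measurable]: "R \<in> borel_measurable M" "R' \<in> borel_measurable M"
    unfolding R_def R'_def by measurable
  \<comment> \<open>\<open>c\<close> and \<open>c'\<close> arise from the two orders in which the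
    processes enter \<open>some_serves_origin_iff\<close>; being inverse to each other, they make
    the two resulting events comparable.\<close>
  define c where "c = (p\<^sub>p / p\<^sub>g) powr (1 / \<alpha>)"
  define c' where "c' = (p\<^sub>g / p\<^sub>p) powr (1 / \<alpha>)"
  have c: "0 < c" "0 < c'" "c * c' = 1"
    using assms(4,5) by (auto simp: c_def c'_def powr_mult[symmetric])
  have R_finite: "\<exists>r\<ge>0. R \<omega> = ennreal r" if "\<omega> \<in> space M" for \<omega>
  proof -
    have "\<Phi>\<^sub>g \<omega> \<noteq> {}" using grid[OF that] square_grid_nonempty by simp
    from nearest_distance_attained[OF lf(1)[OF that] this] show ?thesis
      unfolding R_def by (metis norm_ge_zero)
  qed
  define E where "E = (LBINT r:{0..sqrt 2}. (1 - pi / 4 * r\<^sup>2) * f r) +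
           (LBINT r:{1..sqrt 2}. (r\<^sup>2 * arccos (1 / r) - sqrt (r\<^sup>2 - 1)) * f r)"
  \<comment> \<open>With the grid distance frozen at \<open>r\<close>, a disc of radius
    \<open>c * r\<close> is void of Poisson points with probability
    \<open>exp (- K * r\<^sup>2)\<close>.\<close>
  define K where "K = lam\<^sub>p * pi * c\<^sup>2"

  \<comment> \<open>Rescaling the cell to side 2 multiplies squared norms by
    \<open>s\<^sup>2 / 4\<close>, which turns the rate \<open>K\<close> into the rate of the given
    density.\<close>
  have f: "f r = 2 * (K * s\<^sup>2 / 4) * r * exp (- (K * s\<^sup>2 / 4) * r\<^sup>2)" for r
  proof -
    have "c\<^sup>2 = \<eta> powr (2 / \<alpha>)"
      using assms(4,5) by (simp add: c_def assms(11) power2_eq_square powr_add[symmetric])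
    then have "K * s\<^sup>2 / 4 = pi * (\<rho> * \<eta> powr (2 / \<alpha>) / 4)"
      by (simp add: K_def s assms(10))
    then show ?thesis by (simp only: assms(12) mult.assoc minus_mult_left)
  qed
  have "0 \<le> K * s\<^sup>2 / 4" using assms(3) by (simp add: K_def)
  note square = nn_integral_square_one_minus_exp[OF this f, folded E_def]
  have E: "(\<integral>\<^sup>+ \<omega>. ennreal (1 - exp (- K * (enn2real (R \<omega>))\<^sup>2)) \<partial>M) = ennreal E"
  proof -
    \<comment> \<open>The law of \<open>U\<close> places it in the central cell only almost surely,
      and only there is the grid distance known to be \<open>norm (U \<omega>)\<close>.\<close>
    have "AE u in distr M borel U. u \<in> ?Q"
      unfolding dU by (rule AE_uniform_measureI) (auto simp: closed_Times borel_closed)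
    then have "AE \<omega> in M. U \<omega> \<in> ?Q"
      by (rule AE_distrD[rotated]) measurable
    then have "AE \<omega> in M. enn2real (R \<omega>) = norm (U \<omega>)"
      using AE_space by eventually_elim (simp add: R_def grid nearest_distance_square_grid del: mem_Times_iff)
    then have "(\<integral>\<^sup>+ \<omega>. ennreal (1 - exp (- K * (enn2real (R \<omega>))\<^sup>2)) \<partial>M)
        = (\<integral>\<^sup>+ \<omega>. ennreal (1 - exp (- K * (norm (U \<omega>))\<^sup>2)) \<partial>M)"
      by (intro nn_integral_cong_AE) auto
    also have "\<dots> = (\<integral>\<^sup>+ u. ennreal (1 - exp (- K * (norm u)\<^sup>2)) \<partial>uniform_measure lborel ?Q)"
      unfolding dU[symmetric] by (subst nn_integral_distr) auto
    also have "\<dots> = (\<integral>\<^sup>+ v \<in> {-1..1} \<times> {-1..1}. ennreal (1 - exp (- K * (norm ((s / 2) *\<^sub>R (v::plane)))\<^sup>2)) \<partial>lborel) / 4"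
      using s(1) by (subst nn_integral_uniform_square) auto
    also have "\<dots> = (\<integral>\<^sup>+ v \<in> {-1..1} \<times> {-1..1}. ennreal (1 - exp (- (K * s\<^sup>2 / 4) * (norm (v::plane))\<^sup>2)) \<partial>lborel) / 4"
      by (simp add: power_mult_distrib power_divide mult.assoc)
    also have "(\<integral>\<^sup>+ v \<in> {-1..1} \<times> {-1..1}. ennreal (1 - exp (- (K * s\<^sup>2 / 4) * (norm (v::plane))\<^sup>2)) \<partial>lborel) = ennreal (4 * E)"
      by (rule square)
    also have "ennreal (4 * E) / 4 = ennreal E"
      using square(2) divide_ennreal[of "4 * E" 4] by simp
    finally show ?thesis .
  qed

  have ind: "indep_var borel R borel R'"
    using indep_var_compose[OF assms(9) nearest_distance_measurable nearest_distance_measurable]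
    by (simp add: R_def R'_def comp_def)
  \<comment> \<open>One computation serves both kinds of station: \<open>P\<close> is later the
    non-strict inequality for the Poisson event and the strict one for the complement of the grid
    event.\<close>
  have split: "emeasure M {\<omega> \<in> space M. P (R \<omega>) (R' \<omega>)} = ennreal E"
    if "{z \<in> space (borel \<Otimes>\<^sub>M borel). P (fst z) (snd z)} \<in> sets (borel \<Otimes>\<^sub>M borel)"
      and "\<And>r. 0 \<le> r \<Longrightarrow> emeasure M {\<omega> \<in> space M. P (ennreal r) (R' \<omega>)} = ennreal (1 - exp (- K * r\<^sup>2))"
    for P
    unfolding emeasure_indep_var_Collect[OF ind that(1)] E[symmetric]
    using R_finite that(2) by (intro nn_integral_cong) fastforce

  have "assoc_event_poisson M \<alpha> p\<^sub>g p\<^sub>p \<Phi>\<^sub>g \<Phi>\<^sub>p = {\<omega> \<in> space M. R' \<omega> \<le> ennreal c * R \<omega>}"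
  proof -
    have "(\<exists>X \<in> \<Phi>\<^sub>p \<omega>. serves_origin \<alpha> (base_stations p\<^sub>g p\<^sub>p (\<Phi>\<^sub>g \<omega>) (\<Phi>\<^sub>p \<omega>)) (X, p\<^sub>p))
        \<longleftrightarrow> R' \<omega> \<le> ennreal c * R \<omega>" if \<omega>: "\<omega> \<in> space M" for \<omega>
    \<comment> \<open>Without Poisson points both sides are false, since \<open>R' \<omega>\<close>
      is infinite and \<open>ennreal c * R \<omega>\<close> is finite.\<close>
    proof (cases "\<Phi>\<^sub>p \<omega> = {}")
      case True
      then show ?thesis using R_finite[OF \<omega>] by (auto simp: R'_def top_unique ennreal_mult_eq_top_iff)
    next
      case False
      then show ?thesis unfolding R_def R'_def c_def
        using assms(4-6) lf[OF \<omega>] by (intro some_serves_origin_iff) (auto simp: base_stations_def)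
    qed
    then show ?thesis unfolding assoc_event_poisson_def by auto
  qed
  moreover have "emeasure M {\<omega> \<in> space M. R' \<omega> \<le> ennreal c * R \<omega>} = ennreal E"
  proof (rule split)
    show "{z \<in> space (borel \<Otimes>\<^sub>M borel). snd z \<le> ennreal c * fst z} \<in> sets (borel \<Otimes>\<^sub>M borel)"
      by measurable
    show "emeasure M {\<omega> \<in> space M. R' \<omega> \<le> ennreal c * ennreal r} = ennreal (1 - exp (- K * r\<^sup>2))"
      if "0 \<le> r" for r
      using poisson_process_nearest_distance(1)[OF assms(1,8), of "c * r"] that c
      by (simp add: R'_def ennreal_mult K_def power_mult_distrib mult.assoc)
  qed
  ultimately have Ap: "emeasure M (assoc_event_poisson M \<alpha> p\<^sub>g p\<^sub>p \<Phi>\<^sub>g \<Phi>\<^sub>p) = ennreal E" by simp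

  \<comment> \<open>The complement of the grid event. It differs from the Poisson event only by
    ties, and \<open>split\<close> gives it the same probability \<open>E\<close>.\<close>
  let ?B = "{\<omega> \<in> space M. ennreal c' * R' \<omega> < R \<omega>}"
  have "assoc_event_grid M \<alpha> p\<^sub>g p\<^sub>p \<Phi>\<^sub>g \<Phi>\<^sub>p = space M - ?B"
  proof -
    have "(\<exists>X \<in> \<Phi>\<^sub>g \<omega>. serves_origin \<alpha> (base_stations p\<^sub>g p\<^sub>p (\<Phi>\<^sub>g \<omega>) (\<Phi>\<^sub>p \<omega>)) (X, p\<^sub>g))
        \<longleftrightarrow> R \<omega> \<le> ennreal c' * R' \<omega>" if \<omega>: "\<omega> \<in> space M" for \<omega>
      unfolding R_def R'_def c'_def
      using assms(4-6) lf[OF \<omega>] grid[OF \<omega>] square_grid_nonempty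
      by (intro some_serves_origin_iff) (auto simp: base_stations_def)
    then show ?thesis unfolding assoc_event_grid_def
      by (simp add: not_less set_diff_eq cong: conj_cong)
  qed
  moreover have "?B \<in> events" by measurable
  ultimately have Ag: "prob (assoc_event_grid M \<alpha> p\<^sub>g p\<^sub>p \<Phi>\<^sub>g \<Phi>\<^sub>p) = 1 - prob ?B"
    using prob_compl by simp
  have "emeasure M ?B = ennreal E"
  proof (rule split)
    show "{z \<in> space (borel \<Otimes>\<^sub>M borel). ennreal c' * snd z < fst z} \<in> sets (borel \<Otimes>\<^sub>M borel)"
      by measurable
    fix r :: real assume r: "0 \<le> r"
    \<comment> \<open>Multiplication by \<open>c\<close> and \<open>c * c' = 1\<close> turn the
      condition into one on the Poisson distance alone; for infinite \<open>x\<close> both sides are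
      false.\<close>
    have "ennreal c' * x < ennreal r \<longleftrightarrow> x < ennreal (c * r)" for x
    proof (cases x)
      case (real t)
      have ct: "c * (c' * t) = t" using c(3) by (metis mult.assoc mult_1)
      have "c' * t < r \<longleftrightarrow> t < c * r"
        using mult_less_cancel_left_pos[OF c(1), of "c' * t" r] unfolding ct by (rule sym)
      then show ?thesis using real c r by (simp add: ennreal_mult[symmetric] ennreal_less_iff)
    next
      case top
      then show ?thesis using c by (simp add: ennreal_mult_top)
    qed
    then show "emeasure M {\<omega> \<in> space M. ennreal c' * R' \<omega> < ennreal r} = ennreal (1 - exp (- K * r\<^sup>2))"
      using poisson_process_nearest_distance(2)[OF assms(1,8), of "c * r"] r c
      by (simp add: R'_def K_def power_mult_distrib mult.assoc)
  qed
  then have "prob ?B = prob (assoc_event_poisson M \<alpha> p\<^sub>g p\<^sub>p \<Phi>\<^sub>g \<Phi>\<^sub>p)"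
    using Ap by (simp add: measure_def)
  moreover have "prob (assoc_event_poisson M \<alpha> p\<^sub>g p\<^sub>p \<Phi>\<^sub>g \<Phi>\<^sub>p) = E"
    using Ap square(2) by (simp add: measure_def)
  ultimately show ?thesis using Ag by (simp add: E_def)
qed

end
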